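(* For each $i\in\{1,2,3\}$, the set $\mathcal{P}_i$ of $P$-positions of the game Blocking-$i$ Wythoff Nim equals $\mathcal{R}_i$, where, with $\phi=\frac{1+\sqrt5}{2}$ and $\mathbb{N}_0=\{0,1,2,\dots\}$, \begin{align*} \mathcal{R}_1 &= \{\{\lfloor \phi n\rfloor,\lfloor \phi^2 n\rfloor\}\mid n\in\mathbb{N}_0\},\\ \mathcal{R}_2 &= \{(0,0)\}\cup\{\{n,2n+1\}\mid n\in\mathbb{N}_0\}\cup\{(2x+2,2y+2)\mid (x,y)\in\mathcal{R}_1\},\\ \mathcal{R}_3 &= \{(0,0)\}\cup\{\{n,2n+1\},\{n,2n+2\}\mid n\in\mathbb{N}_0\}. \end{align*} That is, $\mathcal{P}_1=\mathcal{R}_1$, $\mathcal{P}_2=\mathcal{R}_2$ and $\mathcal{P}_3=\mathcal{R}_3$.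
   Context: Let $\mathbb{N}$ and $\mathbb{N}_0$ be the positive and the non-negative integers. Positions are elements $(x,y)$ of $\mathbb{N}_0\times\mathbb{N}_0$. Options (Wythoff Nim): for a position $(x,y)$, the options of $(x,y)$ are the positions $(x-i,y-j)$, with $i,j$ non-negative integers, where one of the following holds: $0=i<j\le y$ (vertical); $0=j<i\le x$ (horizontal); $0<i=j\le\min\{x,y\}$ (diagonal). Blocking-$k$ Wythoff Nim ($k\in\mathbb{N}$): two players alternate moving from the current position to one of its options, but before each move the previous player (the one not about to move) may declare at most $k-1$ of the options forbidden for that move; after the move the blocking is forgotten. A player unable to move because all options are forbidden (or there are none) loses. $P$-positions: the value of a position is defined recursively. A position is $P$ if strictly fewer than $k$ of its options are $P$; otherwise it is $N$. $\mathcal{P}_k\subset\mathbb{N}_0\times\mathbb{N}_0$ denotes the set of $P$-positions of Blocking-$k$ Wythoff Nim. Symmetric notation: $\{x,y\}$ is used for unordered pairs (possibly $x=y$), i.e. $(x,y)$ and $(y,x)$ are considered the same; a set of positions described with elements $\{x,y\}$ is understood as the subset of $\mathbb{N}_0\times\mathbb{N}_0$ containing both $(x,y)$ and $(y,x)$. In particular $(x,y)\in\mathcal{R}_1$ if and only if $(y,x)\in\mathcal{R}_1$. *)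

theory Defs
  imports Complex_Main
begin

section \<open>Blocking Wythoff Nim\<close>

fun options :: "nat \<times> nat \<Rightarrow> (nat \<times> nat) set" where
  "options (x, y) = {(x - i, y - j) | i j.
      (0 = i \<and> i < j \<and> j \<le> y) \<or>
      (0 = j \<and> j < i \<and> i \<le> x) \<or>
      (0 < i \<and> i = j \<and> i \<le> min x y)}"

lemma options_decreasing:
  assumes "q \<in> options p"
  shows "fst q + snd q < fst p + snd p"
  using assms by (cases p) auto

text \<open>The cardinality in the definition of P-positions is always that of a finite set.\<close>

lemma options_finite: "finite (options p)"
proof (rule finite_subset)
  show "options p \<subseteq> {..fst p} \<times> {..snd p}"
    by (cases p) auto
qed simp

context
  notes conj_cong [fundef_cong]
begin

function is_P :: "nat \<Rightarrow> nat \<times> nat \<Rightarrow> bool" where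
  "is_P k p \<longleftrightarrow> card {q. q \<in> options p \<and> is_P k q} < k"
  by auto
termination
  by (relation "Wellfounded.measure (\<lambda>(k, p). fst p + snd p)") (auto dest: options_decreasing)

end

text \<open>As a rewrite rule the recursion equation of \<open>is_P\<close> would loop.\<close>

declare is_P.simps [simp del]

definition P_positions :: "nat \<Rightarrow> (nat \<times> nat) set" where
  "P_positions k = {p. is_P k p}"

section \<open>The candidate sets\<close>

definition phi :: real where
  "phi = (1 + sqrt 5) / 2"

text \<open>A family of unordered pairs \<open>{a n, b n}\<close>, \<open>n \<ge> 0\<close>, read as the set of positions
  containing both orderings of each pair.\<close>

definition unordered_pairs :: "(nat \<Rightarrow> nat) \<Rightarrow> (nat \<Rightarrow> nat) \<Rightarrow> (nat \<times> nat) set" where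
  "unordered_pairs a b = (\<Union>n. {(a n, b n), (b n, a n)})"

definition R1 :: "(nat \<times> nat) set" where
  "R1 = unordered_pairs (\<lambda>n. nat \<lfloor>phi * real n\<rfloor>) (\<lambda>n. nat \<lfloor>phi ^ 2 * real n\<rfloor>)"

definition R2 :: "(nat \<times> nat) set" where
  "R2 = {(0, 0)} \<union> unordered_pairs (\<lambda>n. n) (\<lambda>n. 2 * n + 1)
          \<union> {(2 * x + 2, 2 * y + 2) | x y. (x, y) \<in> R1}"

definition R3 :: "(nat \<times> nat) set" where
  "R3 = {(0, 0)} \<union> unordered_pairs (\<lambda>n. n) (\<lambda>n. 2 * n + 1)
          \<union> unordered_pairs (\<lambda>n. n) (\<lambda>n. 2 * n + 2)"

end

theory Submission
  imports Defs
begin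

text \<open>The set of P-positions is the only set \<open>R\<close> such that a position lies in \<open>R\<close> iff fewer than
  \<open>k\<close> of its options do, so each candidate is checked against this property. For \<open>R\<^sub>1\<close> it rests on
  the complementarity of the Beatty sequences of \<open>\<phi>\<close> and \<open>\<phi>\<^sup>2\<close>. For \<open>R\<^sub>2\<close>, a position \<open>(x, y)\<close> outside \<open>R\<^sub>2\<close>
  with \<open>0 < x \<le> y \<le> 2x\<close> has an option in \<open>R\<^sub>2\<close> on its diagonal; a second one is on the row or column of an odd
  coordinate, or comes from the case \<open>k = 1\<close> when both coordinates are even. For \<open>R\<^sub>3\<close> everything is
  linear arithmetic.\<close>

section \<open>Characterising the P-positions\<close>

text \<open>Eliminating the move lengths and the truncated subtractions turns membership into linear
  arithmetic on coordinates.\<close>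

lemma mem_options_iff:
  "(u, v) \<in> options (x, y) \<longleftrightarrow>
     u = x \<and> v < y \<or> v = y \<and> u < x \<or> u < x \<and> v < y \<and> x + v = u + y"
  (is "_ \<longleftrightarrow> ?R")
proof
  assume ?R
  then consider "u = x" "v < y" | "v = y" "u < x" | "u < x" "v < y" "x + v = u + y" by blast
  then show "(u, v) \<in> options (x, y)"
  proof cases
    case 1
    then show ?thesis
      unfolding options.simps mem_Collect_eq by (intro exI[of _ 0] exI[of _ "y - v"]) auto
  next
    case 2
    then show ?thesis
      unfolding options.simps mem_Collect_eq by (intro exI[of _ "x - u"] exI[of _ 0]) auto
  next
    case 3
    then show ?thesis
      unfolding options.simps mem_Collect_eq by (intro exI[of _ "x - u"]) auto
  qed
qed auto

declare options.simps [simp del]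

lemma mem_options_swap_iff: "(u, v) \<in> options (x, y) \<longleftrightarrow> (v, u) \<in> options (y, x)"
  unfolding mem_options_iff by linarith

text \<open>Options have a smaller coordinate sum, so by induction on this sum the P-options are
  exactly the options in \<open>R\<close>.\<close>

lemma P_positions_eqI:
  assumes "\<And>p. p \<in> R \<longleftrightarrow> card (options p \<inter> R) < k"
  shows "P_positions k = R"
proof -
  have "is_P k p \<longleftrightarrow> p \<in> R" for p
  proof (induction "fst p + snd p" arbitrary: p rule: less_induct)
    case less
    then have "{q. q \<in> options p \<and> is_P k q} = options p \<inter> R"
      using options_decreasing by blast
    then show ?case
      using assms[of p] is_P.simps[of k p] by simp
  qed
  then show ?thesis
    by (auto simp: P_positions_def)
qed

text \<open>Swapping coordinates maps the options of \<open>(x, y)\<close> bijectively to those of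
  \<open>(y, x)\<close>.\<close>

lemma P_positions_eqI_symmetric:
  assumes sym: "\<And>x y. (x, y) \<in> R \<Longrightarrow> (y, x) \<in> R"
    and R: "\<And>x y. x \<le> y \<Longrightarrow> (x, y) \<in> R \<longleftrightarrow> card (options (x, y) \<inter> R) < k"
  shows "P_positions k = R"
proof (rule P_positions_eqI)
  have swap: "card (options (x, y) \<inter> R) = card (options (y, x) \<inter> R)" for x y
  proof (rule bij_betw_same_card)
    show "bij_betw prod.swap (options (x, y) \<inter> R) (options (y, x) \<inter> R)"
      by (rule bij_betw_byWitness[where f' = prod.swap])
         (use mem_options_swap_iff sym in fastforce)+
  qed
  have "(x, y) \<in> R \<longleftrightarrow> card (options (x, y) \<inter> R) < k" for x y
  proof (cases "x \<le> y")
    case False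
    then have "(y, x) \<in> R \<longleftrightarrow> card (options (x, y) \<inter> R) < k"
      using R[of y x] swap[of x y] by simp
    then show ?thesis using sym by blast
  qed (rule R)
  then show "p \<in> R \<longleftrightarrow> card (options p \<inter> R) < k" for p
    by (cases p) simp
qed

lemma card_options_lessI:
  assumes "options p \<inter> R \<subseteq> A" "finite A" "card A < k"
  shows "card (options p \<inter> R) < k"
  using card_mono[OF assms(2,1)] assms(3) by (rule le_less_trans)

lemma card_options_not_lessI:
  assumes "A \<subseteq> options p \<inter> R" "k \<le> card A"
  shows "\<not> card (options p \<inter> R) < k"
  using assms card_mono[OF finite_Int[OF disjI1[OF options_finite]], of A p R] by linarith

lemma mem_unordered_pairs_iff:
  "(x, y) \<in> unordered_pairs a b \<longleftrightarrow> (\<exists>n. x = a n \<and> y = b n \<or> x = b n \<and> y = a n)"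
  by (auto simp: unordered_pairs_def)

section \<open>Wythoff pairs\<close>

definition wythoff :: "nat \<Rightarrow> nat" where
  "wythoff n = nat \<lfloor>phi * real n\<rfloor>"

lemma phi_gt_1: "1 < phi"
proof -
  have "1 < sqrt 5" by simp
  then show ?thesis by (simp add: phi_def)
qed

lemma phi_mult_phi: "phi * phi = phi + 1"
  by (simp add: phi_def field_simps)

text \<open>Irrationality of the golden ratio by infinite descent: if \<open>0 < n\<close> then
  \<open>n < m\<close>, and \<open>(n, m - n)\<close> is a solution with smaller second
  entry.\<close>

lemma golden_ratio_equation_nat:
  fixes m n :: nat
  assumes "m * m = m * n + n * n"
  shows "n = 0"
  using assms
proof (induction n arbitrary: m rule: less_induct)
  case (less n)
  show ?case
  proof (rule ccontr)
    assume "n \<noteq> 0"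
    have "n < m"
    proof (rule ccontr)
      assume "\<not> n < m"
      then have "m * m \<le> m * n" by simp
      with less.prems \<open>n \<noteq> 0\<close> show False by simp
    qed
    then obtain r where r: "m = n + r" "0 < r"
      by (metis less_imp_add_positive)
    have eq: "n * n = n * r + r * r"
      using less.prems unfolding r by (simp add: algebra_simps)
    have "r < n"
    proof (rule ccontr)
      assume "\<not> r < n"
      then have "n * n \<le> n * r" by simp
      with eq r show False by simp
    qed
    with less.IH[OF _ eq] r show False by simp
  qed
qed

lemma phi_mult_nat_neq:
  assumes "0 < n"
  shows "phi * real n \<noteq> real m"
proof
  assume *: "phi * real n = real m"
  have "real m * real m = (phi * phi) * (real n * real n)"
    unfolding *[symmetric] by (simp only: ac_simps)
  also have "\<dots> = (phi * real n) * real n + real n * real n"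
    unfolding phi_mult_phi by (simp add: algebra_simps)
  also have "\<dots> = real m * real n + real n * real n"
    unfolding * ..
  finally have "real (m * m) = real (m * n + n * n)" by simp
  then have "m * m = m * n + n * n"
    by (simp only: of_nat_eq_iff)
  from golden_ratio_equation_nat[OF this] assms show False by simp
qed

lemma wythoff_eq_iff: "wythoff n = m \<longleftrightarrow> real m \<le> phi * real n \<and> phi * real n < real m + 1"
proof -
  have "0 \<le> phi * real n" using phi_gt_1 by simp
  then show ?thesis
    unfolding wythoff_def by (subst nat_eq_iff) (auto simp: floor_eq_iff)
qed

text \<open>As \<open>phi ^ 2 = phi + 1\<close>, the pair with index \<open>n\<close> has coordinate
  difference \<open>n\<close>.\<close>

lemma nat_floor_phi_squared: "nat \<lfloor>phi ^ 2 * real n\<rfloor> = wythoff n + n"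
proof -
  have "phi ^ 2 * real n = phi * real n + of_int (int n)"
    by (simp add: power2_eq_square phi_mult_phi algebra_simps)
  then have "\<lfloor>phi ^ 2 * real n\<rfloor> = \<lfloor>phi * real n\<rfloor> + int n"
    by (simp only: floor_add_int)
  moreover have "0 \<le> \<lfloor>phi * real n\<rfloor>" using phi_gt_1 by simp
  ultimately show ?thesis by (simp add: wythoff_def nat_add_distrib)
qed

lemma wythoff_0 [simp]: "wythoff 0 = 0"
  by (simp add: wythoff_def)

lemma wythoff_bounds: "real (wythoff n) \<le> phi * real n" "phi * real n < real (wythoff n) + 1"
  using wythoff_eq_iff by blast+

lemma wythoff_ge: "n \<le> wythoff n"
proof -
  have "real n \<le> phi * real n" using phi_gt_1 by (simp add: mult_le_cancel_right1)
  then show ?thesis using wythoff_bounds(2)[of n] by linarith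
qed

lemma strict_mono_wythoff: "strict_mono wythoff"
  unfolding strict_mono_Suc_iff
proof
  fix n
  have "phi * real (Suc n) = phi * real n + phi" by (simp add: algebra_simps)
  then show "wythoff n < wythoff (Suc n)"
    using wythoff_bounds(1)[of n] wythoff_bounds(2)[of "Suc n"] phi_gt_1 by linarith
qed

text \<open>Beatty's argument: dividing the bounds that define the two floors by \<open>\<phi>\<close> and \<open>\<phi>\<^sup>2\<close> and adding,
  \<open>1 / \<phi> + 1 / \<phi>\<^sup>2 = 1\<close> puts the integer \<open>n + m\<close> strictly between \<open>N\<close> and \<open>N + 1\<close>. Irrationality of
  \<open>\<phi>\<close> makes the lower bound strict.\<close>

lemma wythoff_disjoint:
  assumes "wythoff n = wythoff m + m"
  shows "m = 0"
proof (rule ccontr)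
  assume "m \<noteq> 0"
  define N where "N = wythoff n"
  have "n \<noteq> 0" using assms \<open>m \<noteq> 0\<close> wythoff_0 by (metis add_is_0)
  have 1: "real N < phi * real n" "phi * real n < real N + 1"
    using wythoff_bounds[of n] phi_mult_nat_neq[of n N] \<open>n \<noteq> 0\<close> by (auto simp: N_def)
  have 2: "real N \<le> (phi + 1) * real m" "(phi + 1) * real m < real N + 1"
    using wythoff_bounds[of m] assms by (auto simp: N_def algebra_simps)
  have pp: "0 < phi" using phi_gt_1 by simp
  \<comment> \<open>Denominators are cleared: \<open>phi\<close> times the bounds for
    \<open>n\<close> is added to the bounds for \<open>m\<close>.\<close>
  have e: "phi * (phi * real n) + (phi + 1) * real m = (phi + 1) * (real n + real m)"
    using phi_mult_phi by (simp add: algebra_simps flip: mult.assoc)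
  have "phi * real N < phi * (phi * real n)" "phi * (phi * real n) < phi * (real N + 1)"
    using 1 pp by simp_all
  then have "(phi + 1) * real N < (phi + 1) * (real n + real m)"
    "(phi + 1) * (real n + real m) < (phi + 1) * (real N + 1)"
    using e 2 by (auto simp: algebra_simps)
  then have "real N < real (n + m)" "real (n + m) < real (Suc N)"
    using pp by simp_all
  then show False by (simp only: of_nat_less_iff)
qed

text \<open>Take the largest \<open>n\<close> with \<open>phi * real n < real x + 1\<close>. If
  \<open>wythoff n\<close> is not \<open>x\<close>, then \<open>phi * real n < real x\<close> and
  \<open>real x + 1 < phi * (real n + 1)\<close>; multiplied by \<open>phi\<close>, these give
  \<open>wythoff (x - n) = n\<close>.\<close>

lemma wythoff_cover:
  obtains n where "x = wythoff n" | n where "x = wythoff n + n"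
proof -
  have pp: "0 < phi" using phi_gt_1 by simp
  define n where "n = nat \<lfloor>(real x + 1) / phi\<rfloor>"
  have nonneg: "0 \<le> (real x + 1) / phi" using pp by simp
  have n: "real n \<le> (real x + 1) / phi" "(real x + 1) / phi < real n + 1"
    using nonneg by (simp_all add: n_def)
  have lo: "phi * real n \<le> real x + 1" and up: "real x + 1 < phi * (real n + 1)"
    using n pp by (simp_all add: field_simps)
  \<comment> \<open>Equality with \<open>n > 0\<close> would make \<open>phi\<close>
    rational.\<close>
  have "phi * real n < real x + 1"
  proof (cases "n = 0")
    case False
    then show ?thesis using lo phi_mult_nat_neq[of n "Suc x"] by simp
  qed simp
  show thesis
  proof (cases "real x \<le> phi * real n")
    case True
    with \<open>phi * real n < real x + 1\<close> have "wythoff n = x"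
      by (simp add: wythoff_eq_iff)
    then show ?thesis using that(1) by blast
  next
    case False
    have "real n \<le> phi * real n" using phi_gt_1 by (simp add: mult_le_cancel_right1)
    with False have "n < x" by linarith
    define m where "m = x - n"
    have m: "real x = real n + real m" using \<open>n < x\<close> by (simp add: m_def)
    have "phi * (phi * real n) < phi * real x"
      using False pp by simp
    then have "(phi + 1) * real n < phi * real x"
      by (simp add: phi_mult_phi flip: mult.assoc)
    then have l: "real n \<le> phi * real m"
      by (simp add: m algebra_simps)
    have "phi * (real x + 1) < phi * (phi * (real n + 1))"
      using up pp by simp
    then have "phi * (real x + 1) < (phi + 1) * (real n + 1)"
      by (simp only: phi_mult_phi flip: mult.assoc)
    then have "phi * real m < real n + 1"
      by (simp add: m algebra_simps)
    with l have "wythoff m = n" by (simp add: wythoff_eq_iff)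
    then show ?thesis using that(2)[of m] \<open>n < x\<close> by (simp add: m_def)
  qed
qed

section \<open>The set \<open>R\<^sub>1\<close>\<close>

lemma mem_R1_iff:
  "(x, y) \<in> R1 \<longleftrightarrow>
     (\<exists>n. x = wythoff n \<and> y = wythoff n + n \<or> x = wythoff n + n \<and> y = wythoff n)"
  unfolding R1_def mem_unordered_pairs_iff nat_floor_phi_squared wythoff_def[symmetric] ..

lemma R1_sym: "(x, y) \<in> R1 \<Longrightarrow> (y, x) \<in> R1"
  by (auto simp: mem_R1_iff)

text \<open>Follows from \<open>wythoff_ge\<close>; it keeps the doubled pairs of \<open>R2\<close>
  strictly below the line \<open>y = 2 * x + 1\<close>.\<close>

lemma R1_le_double:
  assumes "(x, y) \<in> R1"
  shows "y \<le> 2 * x"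
  using assms wythoff_ge by (fastforce simp: mem_R1_iff)

text \<open>If \<open>x\<close> comes from the same sequence twice, strict monotonicity equates the
  indices; if from both sequences, \<open>wythoff_disjoint\<close> leaves only the origin.\<close>

lemma R1_column_unique:
  assumes "(x, y) \<in> R1" "(x, z) \<in> R1"
  shows "y = z"
proof -
  have inj: "m = n" if "wythoff m = wythoff n" for m n
    using strict_mono_eq[OF strict_mono_wythoff] that by blast
  have inj': "m = n" if "wythoff m + m = wythoff n + n" for m n
    using that strict_monoD[OF strict_mono_wythoff, of m n]
      strict_monoD[OF strict_mono_wythoff, of n m]
    by (cases m n rule: linorder_cases) auto
  from assms obtain m n where
    m: "x = wythoff m \<and> y = wythoff m + m \<or> x = wythoff m + m \<and> y = wythoff m" and
    n: "x = wythoff n \<and> z = wythoff n + n \<or> x = wythoff n + n \<and> z = wythoff n"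
    unfolding mem_R1_iff by blast
  have "m = 0" if "wythoff n = wythoff m + m" using wythoff_disjoint that .
  moreover have "n = 0" if "wythoff m = wythoff n + n" using wythoff_disjoint that .
  ultimately show ?thesis using m n inj[of m n] inj'[of m n] by auto
qed

text \<open>The signed coordinate difference determines both the index and the order of the
  pair.\<close>

lemma R1_diagonal_unique:
  assumes "(x, y) \<in> R1" "(u, v) \<in> R1" "x + v = u + y"
  shows "u = x"
  using assms by (auto simp: mem_R1_iff)

lemma R1_no_option:
  assumes "p \<in> R1" "q \<in> options p"
  shows "q \<notin> R1"
proof
  assume "q \<in> R1"
  obtain x y u v where "p = (x, y)" "q = (u, v)" by fastforce
  with assms \<open>q \<in> R1\<close> show False
    using R1_column_unique[of x y v] R1_column_unique[of y x u] R1_diagonal_unique[of x y u v]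
      R1_sym[of x y] R1_sym[of u v]
    by (auto simp: mem_options_iff)
qed

text \<open>With \<open>d = y - x\<close>, either the pair of index \<open>d\<close> is reached
  along the diagonal, or \<open>x < wythoff d\<close> and the partner of \<open>x\<close> in its
  column lies below \<open>y\<close>.\<close>

lemma R1_option_le:
  assumes "(x, y) \<notin> R1" "x \<le> y"
  obtains u v where "(u, v) \<in> options (x, y)" "(u, v) \<in> R1"
proof -
  define d where "d = y - x"
  have d: "y = x + d" using assms by (simp add: d_def)
  have "wythoff d \<noteq> x"
    using assms d by (auto simp: mem_R1_iff)
  then consider "wythoff d < x" | "x < wythoff d" by linarith
  then show ?thesis
  proof cases
    case 1
    then show ?thesis
      using that[of "wythoff d" "wythoff d + d"] by (auto simp: mem_options_iff mem_R1_iff d)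
  next
    case 2
    show ?thesis
    proof (cases x rule: wythoff_cover)
      case (1 n)
      then have "n < d"
        using 2 strict_mono_less[OF strict_mono_wythoff] by blast
      with 1 show ?thesis
        using that[of x "wythoff n + n"] by (auto simp: mem_options_iff mem_R1_iff d)
    next
      case (2 n)
      then have "wythoff n \<noteq> y"
        using assms by (auto simp: mem_R1_iff)
      with 2 assms have "wythoff n < y" by linarith
      with 2 show ?thesis
        using that[of x "wythoff n"] by (auto simp: mem_options_iff mem_R1_iff)
    qed
  qed
qed

lemma P_positions_1: "P_positions 1 = R1"
proof (rule P_positions_eqI_symmetric)
  fix x y :: nat
  assume "x \<le> y"
  have "card (options (x, y) \<inter> R1) < 1 \<longleftrightarrow> options (x, y) \<inter> R1 = {}"
    using options_finite by simp
  with \<open>x \<le> y\<close> show "(x, y) \<in> R1 \<longleftrightarrow> card (options (x, y) \<inter> R1) < 1"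
    using R1_no_option R1_option_le[of x y] by (metis Int_iff disjoint_iff emptyE)
qed (rule R1_sym)

section \<open>The set \<open>R\<^sub>2\<close>\<close>

lemma mem_R2_iff:
  "(x, y) \<in> R2 \<longleftrightarrow> x = 0 \<and> y = 0 \<or> y = 2 * x + 1 \<or> x = 2 * y + 1 \<or>
     (\<exists>u v. x = 2 * u + 2 \<and> y = 2 * v + 2 \<and> (u, v) \<in> R1)"
  by (auto simp: R2_def mem_unordered_pairs_iff)

lemma R2_sym: "(x, y) \<in> R2 \<Longrightarrow> (y, x) \<in> R2"
  by (auto simp: mem_R2_iff intro: R1_sym)

text \<open>Doubling and shifting respects rows, columns and diagonals, so the case
  \<open>k = 1\<close> carries over to the doubled pairs.\<close>

lemma options_double_iff:
  "(2 * u + 2, 2 * v + 2) \<in> options (2 * x + 2, 2 * y + 2) \<longleftrightarrow> (u, v) \<in> options (x, y)"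
  by (auto simp: mem_options_iff)

lemma card_options_R2_less:
  assumes "(x, y) \<in> R2" "x \<le> y"
  shows "card (options (x, y) \<inter> R2) < 2"
proof -
  from assms consider "x = 0" "y = 0" | "y = 2 * x + 1" |
    u v where "x = 2 * u + 2" "y = 2 * v + 2" "(u, v) \<in> R1"
    by (auto simp: mem_R2_iff)
  then show ?thesis
  proof cases
    case 1
    then have "options (x, y) \<inter> R2 \<subseteq> {}" by (auto simp: mem_options_iff)
    then show ?thesis by (rule card_options_lessI) auto
  next
    case 2
    have col: "fst q = x" if q: "q \<in> options (x, y) \<inter> R2" for q
    proof (rule ccontr)
      assume *: "fst q \<noteq> x"
      obtain a b where ab: "q = (a, b)" by fastforce
      have "\<not> (\<exists>u v. a = 2 * u + 2 \<and> b = 2 * v + 2 \<and> (u, v) \<in> R1)"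
      proof
        assume "\<exists>u v. a = 2 * u + 2 \<and> b = 2 * v + 2 \<and> (u, v) \<in> R1"
        then obtain u v where "a = 2 * u + 2" "b = 2 * v + 2" "(u, v) \<in> R1" by blast
        moreover from this have "v \<le> 2 * u" using R1_le_double by blast
        ultimately show False using q * ab 2 by (auto simp: mem_options_iff)
      qed
      with q * ab 2 show False by (auto simp: mem_options_iff mem_R2_iff)
    qed
    \<comment> \<open>Besides the doubled partner of an even \<open>x\<close>, only
      \<open>x = 2 * v + 1\<close> is left; for \<open>x = 0\<close> truncation gives the
      origin.\<close>
    have below: "if even x \<and> x \<noteq> 0 then \<exists>b. v = 2 * b + 2 \<and> ((x - 2) div 2, b) \<in> R1
        else v = (x - 1) div 2"
      if "(x, v) \<in> options (x, y) \<inter> R2" for v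
    proof -
      have "v \<noteq> 2 * x + 1" using that 2 by (auto simp: mem_options_iff)
      with that consider "x = 0" "v = 0" | "x = 2 * v + 1" |
        a b where "x = 2 * a + 2" "v = 2 * b + 2" "(a, b) \<in> R1"
        unfolding Int_iff mem_R2_iff by blast
      then show ?thesis by cases simp_all
    qed
    have "v = w" if "(x, v) \<in> options (x, y) \<inter> R2" "(x, w) \<in> options (x, y) \<inter> R2" for v w
      using below[OF that(1)] below[OF that(2)] R1_column_unique by (metis (full_types))
    then have "\<forall>p \<in> options (x, y) \<inter> R2. \<forall>q \<in> options (x, y) \<inter> R2. p = q"
      using col by (metis prod.collapse)
    then show ?thesis
      using card_le_Suc0_iff_eq[of "options (x, y) \<inter> R2"] options_finite by simp
  next
    case 3
    have "v \<le> 2 * u" using 3 R1_le_double by blast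
    \<comment> \<open>By truncation this is the position \<open>(0, 0)\<close> when \<open>x = y\<close>.\<close>
    have "options (x, y) \<inter> R2 \<subseteq> {(y - x - 1, 2 * (y - x) - 1)}"
    proof safe
      fix a b
      assume q: "(a, b) \<in> options (x, y)" "(a, b) \<in> R2"
      have "\<not> (\<exists>u v. a = 2 * u + 2 \<and> b = 2 * v + 2 \<and> (u, v) \<in> R1)"
        using q 3 options_double_iff R1_no_option by metis
      with q(2) have "a = 0 \<and> b = 0 \<or> b = 2 * a + 1 \<or> a = 2 * b + 1"
        by (auto simp: mem_R2_iff)
      \<comment> \<open>This bound and the even coordinates keep both lines out of the row and
        column options; only the diagonal remains.\<close>
      moreover have "y \<le> 2 * x" using 3(1,2) \<open>v \<le> 2 * u\<close> by simp
      moreover have "y \<noteq> 2 * a + 1" using 3(2) by presburger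
      moreover have "x \<noteq> 2 * b + 1" using 3(1) by presburger
      ultimately show "a = y - x - 1" "b = 2 * (y - x) - 1"
        using q(1) assms(2) by (auto simp: mem_options_iff)
    qed
    then show ?thesis by (rule card_options_lessI) auto
  qed
qed

lemma card_options_R2_not_less:
  assumes "(x, y) \<notin> R2" "x \<le> y"
  shows "\<not> card (options (x, y) \<inter> R2) < 2"
proof -
  have two: ?thesis if "p \<in> options (x, y) \<inter> R2" "q \<in> options (x, y) \<inter> R2" "p \<noteq> q" for p q
    by (rule card_options_not_lessI[of "{p, q}"]) (use that in auto)
  \<comment> \<open>For \<open>2 * x + 1 < y\<close> this supplies a second column option, below
    \<open>(x, 2 * x + 1)\<close>.\<close>
  have small: "\<exists>z \<le> 2 * x. (x, z) \<in> R2"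
  proof (cases "even x")
    case False
    then show ?thesis
      by (intro exI[of _ "(x - 1) div 2"]) (auto simp: mem_R2_iff elim: oddE)
  next
    case True
    show ?thesis
    proof (cases "x = 0")
      case False
      with True have u: "x = 2 * ((x - 2) div 2) + 2" (is "x = 2 * ?u + 2") by presburger
      obtain v where v: "(?u, v) \<in> R1"
        by (cases ?u rule: wythoff_cover) (auto simp: mem_R1_iff)
      then have "2 * v + 2 \<le> 2 * x"
        using R1_le_double[of ?u v] u by linarith
      moreover have "(x, 2 * v + 2) \<in> R2"
        unfolding mem_R2_iff using u v by blast
      ultimately show ?thesis by blast
    qed (auto simp: mem_R2_iff)
  qed
  have "y \<noteq> 2 * x + 1" and "x \<noteq> 0 \<or> y \<noteq> 0" using assms by (auto simp: mem_R2_iff)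
  then consider "2 * x + 1 < y" | "0 < x" "y \<le> 2 * x" using assms(2) by linarith
  then show ?thesis
  proof cases
    case 1
    from small obtain z where "z \<le> 2 * x" "(x, z) \<in> R2" by blast
    with 1 show ?thesis
      by (intro two[of "(x, z)" "(x, 2 * x + 1)"]) (auto simp: mem_options_iff mem_R2_iff)
  next
    case 2
    \<comment> \<open>The diagonal meets the line of slope 2 here; for \<open>x = y\<close>
      truncation gives the origin.\<close>
    define p where "p = (y - x - 1, 2 * (y - x) - 1)"
    have p: "p \<in> options (x, y) \<inter> R2"
      using 2 assms(2) by (auto simp: p_def mem_options_iff mem_R2_iff)
    show ?thesis
    proof (cases "odd x")
      case True
      then obtain c where "x = 2 * c + 1" by (elim oddE)
      then have "(x, c) \<in> options (x, y) \<inter> R2" "(x, c) \<noteq> p"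
        using 2 assms(2) by (auto simp: p_def mem_options_iff mem_R2_iff)
      with p show ?thesis using two by blast
    next
      case x: False
      show ?thesis
      proof (cases "odd y")
        case True
        then obtain c where "y = 2 * c + 1" by (elim oddE)
        then have "(c, y) \<in> options (x, y) \<inter> R2" "(c, y) \<noteq> p"
          using 2 assms(2) x by (auto simp: p_def mem_options_iff mem_R2_iff)
        with p show ?thesis using two by blast
      next
        case False
        obtain u v where uv: "x = 2 * u + 2" "y = 2 * v + 2"
        proof
          show "x = 2 * ((x - 2) div 2) + 2" "y = 2 * ((y - 2) div 2) + 2"
            using 2 x False assms(2) by presburger+
        qed
        then have "(u, v) \<notin> R1" "u \<le> v" using assms by (auto simp: mem_R2_iff)
        then obtain a b where ab: "(a, b) \<in> options (u, v)" "(a, b) \<in> R1"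
          by (rule R1_option_le)
        define q where "q = (2 * a + 2, 2 * b + 2)"
        have "q \<in> options (x, y) \<inter> R2"
          using ab uv options_double_iff by (auto simp: q_def mem_R2_iff)
        \<comment> \<open>The second coordinate of \<open>p\<close> is odd or zero, that of
          \<open>q\<close> even and positive.\<close>
        moreover have "q \<noteq> p" unfolding p_def q_def by (simp, presburger)
        ultimately show ?thesis using p two by blast
      qed
    qed
  qed
qed

lemma P_positions_2: "P_positions 2 = R2"
proof (rule P_positions_eqI_symmetric)
  show "(x, y) \<in> R2 \<longleftrightarrow> card (options (x, y) \<inter> R2) < 2" if "x \<le> y" for x y
    using that card_options_R2_less[of x y] card_options_R2_not_less[of x y] by argo
qed (rule R2_sym)

section \<open>The set \<open>R\<^sub>3\<close>\<close>

lemma mem_R3_iff: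
  "(x, y) \<in> R3 \<longleftrightarrow> x = 0 \<and> y = 0 \<or> y = 2 * x + 1 \<or> x = 2 * y + 1 \<or>
     y = 2 * x + 2 \<or> x = 2 * y + 2"
  by (auto simp: R3_def mem_unordered_pairs_iff)

text \<open>Column \<open>x\<close> has one point below \<open>2 * x + 1\<close>. A further option
  is \<open>(x - 1, 2 * x)\<close> on the diagonal if \<open>y = 2 * x + 1\<close>, and
  \<open>(x, 2 * x + 1)\<close> in the column if \<open>y = 2 * x + 2\<close>.\<close>

lemma card_options_R3_less:
  assumes "(x, y) \<in> R3" "x \<le> y"
  shows "card (options (x, y) \<inter> R3) < 3"
proof -
  have two: "card {p, q} < 3" for p q :: "nat \<times> nat"
    by (cases "p = q") auto
  from assms consider "x = 0" "y = 0" | "y = 2 * x + 1" | "y = 2 * x + 2"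
    by (auto simp: mem_R3_iff)
  then show ?thesis
  proof cases
    case 1
    then have "options (x, y) \<inter> R3 \<subseteq> {}" by (auto simp: mem_options_iff)
    then show ?thesis by (rule card_options_lessI) auto
  next
    case 2
    then have "options (x, y) \<inter> R3 \<subseteq> {(x, (x - 1) div 2), (x - 1, 2 * x)}"
      by (auto simp: mem_options_iff mem_R3_iff; presburger)
    then show ?thesis by (rule card_options_lessI) (auto simp: two)
  next
    case 3
    then have "options (x, y) \<inter> R3 \<subseteq> {(x, (x - 1) div 2), (x, 2 * x + 1)}"
      by (auto simp: mem_options_iff mem_R3_iff; presburger)
    then show ?thesis by (rule card_options_lessI) (auto simp: two)
  qed
qed

lemma card_options_R3_not_less:
  assumes "(x, y) \<notin> R3" "x \<le> y"
  shows "\<not> card (options (x, y) \<inter> R3) < 3"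
proof -
  have three: ?thesis
    if "{p, q, r} \<subseteq> options (x, y) \<inter> R3" "p \<noteq> q" "p \<noteq> r" "q \<noteq> r" for p q r
    by (rule card_options_not_lessI[OF that(1)]) (use that in auto)
  \<comment> \<open>One of \<open>z = 2 * w + 1\<close> and \<open>z = 2 * w + 2\<close> holds for
    this value \<open>w\<close>, except that \<open>z = 0\<close> gives the origin.\<close>
  have small: "(z, (z - 1) div 2) \<in> R3" for z
    unfolding mem_R3_iff by presburger
  have "y \<noteq> 2 * x + 1" "y \<noteq> 2 * x + 2" "x \<noteq> 0 \<or> y \<noteq> 0" using assms by (auto simp: mem_R3_iff)
  then consider "2 * x + 2 < y" | "0 < x" "y \<le> 2 * x" "x + 2 \<le> y" | "0 < x" "y \<le> 2 * x" "y < x + 2"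
    using assms(2) by linarith
  then show ?thesis
  proof cases
    case 1
    then show ?thesis
      using small[of x]
      by (intro three[of "(x, (x - 1) div 2)" "(x, 2 * x + 1)" "(x, 2 * x + 2)"])
         (auto simp: mem_options_iff mem_R3_iff)
  next
    case 2
    \<comment> \<open>The diagonal of difference \<open>e + 2\<close> meets the two lines at first
      coordinates \<open>e + 1\<close> and \<open>e\<close>.\<close>
    define e where "e = y - x - 2"
    have e: "y = x + e + 2" "e + 2 \<le> x"
      using 2 by (auto simp: e_def)
    then have "(x - 1) div 2 < y" "\<And>z. (e, z) \<noteq> (x, (x - 1) div 2)" by auto
    with e show ?thesis
      using small[of x]
      by (intro three[of "(x, (x - 1) div 2)" "(e + 1, 2 * e + 3)" "(e, 2 * e + 2)"])
         (auto simp: mem_options_iff mem_R3_iff)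
  next
    case 3
    \<comment> \<open>Here \<open>y - x\<close> is 0 or 1, and column, row and diagonal give one
      option each.\<close>
    have "((y - 1) div 2, y) \<in> R3" using small[of y] by (auto simp: mem_R3_iff)
    moreover have "(y - 1) div 2 < x" using 3 by linarith
    moreover have "(0, y - x) \<in> R3" using 3 by (auto simp: mem_R3_iff)
    ultimately show ?thesis
      using small[of x] 3 assms(2)
      by (intro three[of "(x, (x - 1) div 2)" "((y - 1) div 2, y)" "(0, y - x)"])
         (auto simp: mem_options_iff)
  qed
qed

lemma P_positions_3: "P_positions 3 = R3"
proof (rule P_positions_eqI_symmetric)
  show "(y, x) \<in> R3" if "(x, y) \<in> R3" for x y using that by (auto simp: mem_R3_iff)
  show "(x, y) \<in> R3 \<longleftrightarrow> card (options (x, y) \<inter> R3) < 3" if "x \<le> y" for x y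
    using that card_options_R3_less[of x y] card_options_R3_not_less[of x y] by argo
qed

theorem theorem1p1:
  "P_positions 1 = R1 \<and> P_positions 2 = R2 \<and> P_positions 3 = R3"
  using P_positions_1 P_positions_2 P_positions_3 by blast

end
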